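(* Let $(X,d)$ be a distance space, let $N$ be any (finite) positive integer, and let $\Gamma$ be a set, possibly with an uncountable number of elements. Then: 1. $X$ is open in $(X,d)$. 2. $\varnothing$ is open in $(X,d)$. 3. If each of the sets $U_1,U_2,\dots,U_N$ is open in $(X,d)$, then $\bigcap_{n=1}^{N}U_n$ is open in $(X,d)$. 4. If each element of a family $\{U_\gamma\subseteq X \mid \gamma\in\Gamma\}$ is open in $(X,d)$, then $\bigcup_{\gamma\in\Gamma}U_\gamma$ is open in $(X,d)$.
   Context: A distance on a set $X$ is a function $d:X\times X\to\mathbb{R}$ such that for all $x,y\in X$: $d(x,y)\ge 0$; $d(x,y)=0\iff x=y$; $d(x,y)=d(y,x)$ (no triangle inequality is assumed). The pair $(X,d)$ is then a distance space. For $x\in X$ and real $r>0$, the open ball is $B(x,r)=\{y\in X\mid d(x,y)<r\}$. A set $U\subseteq X$ is open in $(X,d)$ if for every $x\in U$ there exists a real $r>0$ such that $B(x,r)\subseteq U$. *)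

theory Defs
  imports Complex_Main
begin

(* A distance on X is represented by a total function of which only the values
   on X are constrained; X may be empty, and no triangle inequality is assumed. *)
locale distance_space =
  fixes X :: "'a set" and d :: "'a \<Rightarrow> 'a \<Rightarrow> real"
  assumes nonneg: "x \<in> X \<Longrightarrow> y \<in> X \<Longrightarrow> d x y \<ge> 0"
    and eq_0_iff: "x \<in> X \<Longrightarrow> y \<in> X \<Longrightarrow> d x y = 0 \<longleftrightarrow> x = y"
    and commute: "x \<in> X \<Longrightarrow> y \<in> X \<Longrightarrow> d x y = d y x"

(* The ball and openness are defined outside the locale, so that they are
   meaningful without its axioms; they are meant for x in X and r > 0. *)
definition dist_ball :: "'a set \<Rightarrow> ('a \<Rightarrow> 'a \<Rightarrow> real) \<Rightarrow> 'a \<Rightarrow> real \<Rightarrow> 'a set" where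
  "dist_ball X d x r = {y \<in> X. d x y < r}"

definition dist_open :: "'a set \<Rightarrow> ('a \<Rightarrow> 'a \<Rightarrow> real) \<Rightarrow> 'a set \<Rightarrow> bool" where
  "dist_open X d U \<longleftrightarrow> U \<subseteq> X \<and> (\<forall>x\<in>U. \<exists>r>0. dist_ball X d x r \<subseteq> U)"

end

theory Submission
  imports Defs
begin

text \<open>Balls about one centre are nested by radius (\<open>dist_ball_mono\<close>), so a point
  of two open sets keeps the smaller of its two balls inside both. This is
  \<open>dist_open_Int\<close>, and induction extends it to finite intersections in
  \<open>dist_open_INT\<close>. For unions (\<open>dist_open_UN\<close>), a ball inside one member
  is already inside the union.\<close>

lemma dist_ball_mono: "r \<le> s \<Longrightarrow> dist_ball X d x r \<subseteq> dist_ball X d x s"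
  by (auto simp: dist_ball_def)

lemma dist_open_space: "dist_open X d X"
  by (auto simp: dist_open_def dist_ball_def intro: zero_less_one)

lemma dist_open_empty: "dist_open X d {}"
  by (simp add: dist_open_def)

lemma dist_open_Int:
  assumes "dist_open X d U" and "dist_open X d V"
  shows "dist_open X d (U \<inter> V)"
  unfolding dist_open_def
proof (intro conjI ballI)
  show "U \<inter> V \<subseteq> X"
    using assms by (auto simp: dist_open_def)
next
  fix x assume "x \<in> U \<inter> V"
  then obtain r s where "r > 0" "dist_ball X d x r \<subseteq> U" "s > 0" "dist_ball X d x s \<subseteq> V"
    using assms unfolding dist_open_def by blast
  \<comment> \<open>Finiteness matters here: the minimum of two positive radii is positive, whereas
    infinitely many radii may have infimum 0.\<close>
  then have "min r s > 0" and "dist_ball X d x (min r s) \<subseteq> U \<inter> V"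
    using dist_ball_mono[of "min r s" r X d x] dist_ball_mono[of "min r s" s X d x] by auto
  then show "\<exists>r>0. dist_ball X d x r \<subseteq> U \<inter> V"
    by blast
qed

text \<open>The induction starts at singletons: an intersection over the empty index set is
  \<open>UNIV\<close>, which need not lie inside \<open>X\<close>.\<close>

lemma dist_open_INT:
  assumes "finite I" and "I \<noteq> {}" and "\<And>i. i \<in> I \<Longrightarrow> dist_open X d (U i)"
  shows "dist_open X d (\<Inter>i\<in>I. U i)"
  using assms by (induction rule: finite_ne_induct) (auto intro: dist_open_Int)

text \<open>The radius at a point comes from a single member containing it, so no minimum over
  \<open>I\<close> is taken and \<open>I\<close> can be arbitrary.\<close>

lemma dist_open_UN:
  assumes "\<And>i. i \<in> I \<Longrightarrow> dist_open X d (U i)"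
  shows "dist_open X d (\<Union>i\<in>I. U i)"
  unfolding dist_open_def
proof (intro conjI ballI)
  show "(\<Union>i\<in>I. U i) \<subseteq> X"
    using assms by (auto simp: dist_open_def)
next
  fix x assume "x \<in> (\<Union>i\<in>I. U i)"
  then obtain i r where "i \<in> I" "r > 0" "dist_ball X d x r \<subseteq> U i"
    using assms unfolding dist_open_def by blast
  then show "\<exists>r>0. dist_ball X d x r \<subseteq> (\<Union>i\<in>I. U i)"
    by blast
qed

theorem theorem3p7:
  fixes X :: "'a set" and d :: "'a \<Rightarrow> 'a \<Rightarrow> real"
    and N :: nat and \<Gamma> :: "'g set"
  assumes "distance_space X d" and "N \<ge> 1"
  shows "dist_open X d X \<and>
         dist_open X d {} \<and>
         (\<forall>U :: nat \<Rightarrow> 'a set.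
            (\<forall>n\<in>{1..N}. dist_open X d (U n)) \<longrightarrow> dist_open X d (\<Inter>n\<in>{1..N}. U n)) \<and>
         (\<forall>U :: 'g \<Rightarrow> 'a set.
            (\<forall>\<gamma>\<in>\<Gamma>. dist_open X d (U \<gamma>)) \<longrightarrow> dist_open X d (\<Union>\<gamma>\<in>\<Gamma>. U \<gamma>))"
proof (intro conjI allI impI)
  fix U :: "nat \<Rightarrow> 'a set"
  assume "\<forall>n\<in>{1..N}. dist_open X d (U n)"
  then show "dist_open X d (\<Inter>n\<in>{1..N}. U n)"
    \<comment> \<open>\<open>N \<ge> 1\<close> makes the index set \<open>{1..N}\<close>
      nonempty.\<close>
    using assms(2) by (intro dist_open_INT) auto
next
  fix U :: "'g \<Rightarrow> 'a set"
  assume "\<forall>\<gamma>\<in>\<Gamma>. dist_open X d (U \<gamma>)"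
  then show "dist_open X d (\<Union>\<gamma>\<in>\<Gamma>. U \<gamma>)"
    by (intro dist_open_UN) auto
qed (rule dist_open_space dist_open_empty)+

end
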